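(* Let $G=(V,E)$ be a finite, undirected, connected graph with no loops or parallel edges and with $n=|V|\ge 2$ vertices. Let $(X_s)_{s\ge 0}$ be lazy random walk on $G$, $\pi$ its stationary distribution and $t_{\rm hit}$ its maximum expected hitting time. Then for every integer $t\ge 1$ and every sequence $h_0,h_1,\dots,h_t\in V$, $$\mathbb{P}_\pi\left(\forall\, 0\le s\le t:\ X_s\ne h_s\right)\le\left(1-\frac{1}{t_{\rm hit}}\right)^t.$$
   Context: The degree of $x\in V$ is $d_x$ and $d_{\rm avg}$ is the average degree of $G$. Lazy random walk (LRW) on $G$ is the discrete-time Markov chain $(X_t)_{t\ge 0}$ on $V$ with transition matrix $P(x,x)=\tfrac12$, $P(x,y)=\tfrac{1}{2d_x}$ if $xy\in E$, and $P(x,y)=0$ otherwise. Its stationary distribution is $\pi(x)=\frac{d_x}{d_{\rm avg}\,n}$. $\mathbb{P}_\pi$ denotes probability when $X_0$ has law $\pi$, and $\mathbb{E}_y$ expectation when $X_0=y$. $\tau_x:=\inf\{t\ge 0: X_t=x\}$ and $t_{\rm hit}:=\max_{x,y\in V}\mathbb{E}_y[\tau_x]$. *)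

theory Defs
  imports "HOL-Probability.Probability" "Graph_Theory.Graph_Theory"
begin

text \<open>
  A finite undirected graph without loops or parallel edges is a \<open>graph\<close> of the
  Graph_Theory entry, where an undirected edge is a pair of opposite arcs.  Hence the
  degree of a vertex is its out-degree, and \<open>x\<close>, \<open>y\<close> are adjacent iff
  \<open>(x, y) \<in> arcs_ends G\<close>.
\<close>

definition avg_degree :: "('a, 'b) pre_digraph \<Rightarrow> real" where
  "avg_degree G = (\<Sum>x\<in>verts G. real (out_degree G x)) / real (card (verts G))"

definition lrw_trans :: "('a, 'b) pre_digraph \<Rightarrow> 'a \<Rightarrow> 'a \<Rightarrow> real" where
  "lrw_trans G x y =
    (if y = x then 1 / 2
     else if (x, y) \<in> arcs_ends G then 1 / (2 * real (out_degree G x))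
     else 0)"

definition lrw_stationary :: "('a, 'b) pre_digraph \<Rightarrow> 'a \<Rightarrow> real" where
  "lrw_stationary G x = real (out_degree G x) / (avg_degree G * real (card (verts G)))"

text \<open>
  The law of the walk with initial law \<open>\<mu>\<close> is the Ionescu-Tulcea measure on trajectories
  \<open>nat \<Rightarrow> 'a\<close> whose kernels are \<open>\<mu>\<close> at time 0 and \<open>lrw_trans G (\<omega> s)\<close> at time \<open>Suc s\<close>;
  the random variable \<open>X s\<close> is the coordinate map \<open>\<lambda>\<omega>. \<omega> s\<close>.
\<close>

definition lrw_kernel :: "('a, 'b) pre_digraph \<Rightarrow> 'a measure \<Rightarrow> nat \<Rightarrow> (nat \<Rightarrow> 'a) \<Rightarrow> 'a measure" where
  "lrw_kernel G \<mu> n \<omega> =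
    (case n of
       0 \<Rightarrow> \<mu>
     | Suc s \<Rightarrow> point_measure (verts G) (\<lambda>y. ennreal (lrw_trans G (\<omega> s) y)))"

definition lrw :: "('a, 'b) pre_digraph \<Rightarrow> 'a measure \<Rightarrow> (nat \<Rightarrow> 'a) measure" where
  "lrw G \<mu> =
    projective_family.lim UNIV
      (Ionescu_Tulcea.CI (lrw_kernel G \<mu>) (\<lambda>_. count_space (verts G)))
      (\<lambda>_. count_space (verts G))"

abbreviation lrw_from :: "('a, 'b) pre_digraph \<Rightarrow> 'a \<Rightarrow> (nat \<Rightarrow> 'a) measure" where
  "lrw_from G y \<equiv> lrw G (return (count_space (verts G)) y)"

abbreviation lrw_stat :: "('a, 'b) pre_digraph \<Rightarrow> (nat \<Rightarrow> 'a) measure" where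
  "lrw_stat G \<equiv> lrw G (point_measure (verts G) (\<lambda>x. ennreal (lrw_stationary G x)))"

text \<open>The infimum is taken in \<open>enat\<close>, so it is \<open>\<infinity>\<close> on trajectories that never visit \<open>x\<close>.\<close>

definition hitting_time :: "'a \<Rightarrow> (nat \<Rightarrow> 'a) \<Rightarrow> enat" where
  "hitting_time x \<omega> = Inf (enat ` {t. \<omega> t = x})"

definition t_hit :: "('a, 'b) pre_digraph \<Rightarrow> ennreal" where
  "t_hit G = Max ((\<lambda>(x, y). \<integral>\<^sup>+ \<omega>. ennreal_of_enat (hitting_time x \<omega>) \<partial>lrw_from G y)
                   ` (verts G \<times> verts G))"

lemma out_degree_pos:
  assumes G: "graph G" "Digraph_Component.connected G" and n: "card (verts G) \<ge> 2"
    and x: "x \<in> verts G"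
  shows "out_degree G x > 0"
proof -
  interpret graph G by fact
  have "\<not> verts G \<subseteq> {x}"
    using n card_mono[of "{x}" "verts G"] by fastforce
  then obtain y where y: "y \<in> verts G" "y \<noteq> x" by blast
  have "strongly_connected G"
    using G(2) symmetric_connected_imp_strongly_connected sym_arcs by blast
  then have "x \<rightarrow>\<^sup>*\<^bsub>G\<^esub> y" using x y by auto
  then obtain z where "x \<rightarrow>\<^bsub>G\<^esub> z"
    using y by (metis converse_reachable_cases)
  then obtain e where "e \<in> out_arcs G x" by (auto simp: out_arcs_def)
  then show ?thesis
    unfolding out_degree_def by (auto simp: card_gt_0_iff)
qed

lemma card_neighbours:
  assumes "graph G"
  shows "card {y \<in> verts G. (x, y) \<in> arcs_ends G} = out_degree G x"
proof -
  interpret graph G by fact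
  have "{y \<in> verts G. (x, y) \<in> arcs_ends G} = head G ` out_arcs G x"
    by (auto simp: arcs_ends_conv out_arcs_def)
  moreover have "inj_on (head G) (out_arcs G x)"
    by (rule inj_onI) (auto simp: out_arcs_def arc_to_ends_def intro!: no_multi_arcs)
  ultimately show ?thesis
    unfolding out_degree_def by (simp add: card_image)
qed

lemma lrw_trans_nonneg: "lrw_trans G x y \<ge> 0"
  by (simp add: lrw_trans_def)

lemma sum_lrw_trans:
  assumes G: "graph G" "Digraph_Component.connected G" and n: "card (verts G) \<ge> 2"
    and x: "x \<in> verts G"
  shows "(\<Sum>y\<in>verts G. lrw_trans G x y) = 1"
proof -
  interpret graph G by fact
  have nl: "(x, x) \<notin> arcs_ends G"
    using no_loops by (fastforce simp: arcs_ends_conv)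
  have "(\<Sum>y\<in>verts G. lrw_trans G x y)
      = (\<Sum>y\<in>verts G. (if y = x then 1 / 2 else 0)
          + (if (x, y) \<in> arcs_ends G then 1 / (2 * real (out_degree G x)) else 0))"
    by (intro sum.cong) (use nl in \<open>auto simp: lrw_trans_def\<close>)
  also have "\<dots> = 1 / 2 + real (card {y \<in> verts G. (x, y) \<in> arcs_ends G})
                    * (1 / (2 * real (out_degree G x)))"
    using x by (simp add: sum.distrib sum.If_cases Int_def conj_commute)
  also have "\<dots> = 1"
    using out_degree_pos[OF assms] by (simp add: card_neighbours[OF G(1)])
  finally show ?thesis .
qed

lemma lrw_stationary_nonneg: "lrw_stationary G x \<ge> 0"
  by (auto simp: lrw_stationary_def avg_degree_def intro!: divide_nonneg_nonneg mult_nonneg_nonneg sum_nonneg)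

lemma sum_lrw_stationary:
  assumes G: "graph G" "Digraph_Component.connected G" and n: "card (verts G) \<ge> 2"
  shows "(\<Sum>x\<in>verts G. lrw_stationary G x) = 1"
proof -
  interpret graph G by fact
  have "verts G \<noteq> {}" using n by auto
  moreover from this have "(\<Sum>x\<in>verts G. real (out_degree G x)) > 0"
    using out_degree_pos[OF assms] by (intro sum_pos) auto
  ultimately show ?thesis
    by (simp add: lrw_stationary_def avg_degree_def flip: sum_divide_distrib)
qed

lemma lrw_stationary_invariant:
  assumes G: "graph G" "Digraph_Component.connected G" and n: "card (verts G) \<ge> 2"
    and y: "y \<in> verts G"
  shows "(\<Sum>x\<in>verts G. lrw_stationary G x * lrw_trans G x y) = lrw_stationary G y"
proof -
  interpret graph G by fact
  have "lrw_stationary G x * lrw_trans G x y = lrw_stationary G y * lrw_trans G y x"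
    if "x \<in> verts G" for x
    using out_degree_pos[OF assms(1-3) that] out_degree_pos[OF assms]
      arcs_ends_symmetric[OF sym_arcs, of x y] arcs_ends_symmetric[OF sym_arcs, of y x]
    by (auto simp: lrw_trans_def lrw_stationary_def)
  then show ?thesis
    using sum_lrw_trans[OF assms] by (simp flip: sum_distrib_left)
qed

lemma prob_space_point_measure_sum:
  assumes "finite A" "\<And>x. x \<in> A \<Longrightarrow> f x \<ge> 0" "(\<Sum>x\<in>A. f x) = 1"
  shows "prob_space (point_measure A (\<lambda>x. ennreal (f x)))"
  using assms by (intro prob_spaceI) (simp add: space_point_measure emeasure_point_measure_finite sum_ennreal)

lemma prob_space_lrw_init:
  assumes G: "graph G" "Digraph_Component.connected G" and n: "card (verts G) \<ge> 2"
  shows "prob_space (point_measure (verts G) (\<lambda>x. ennreal (lrw_stationary G x)))"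
    and "y \<in> verts G \<Longrightarrow> prob_space (return (count_space (verts G)) y)"
proof -
  interpret graph G by fact
  show "prob_space (point_measure (verts G) (\<lambda>x. ennreal (lrw_stationary G x)))"
    by (rule prob_space_point_measure_sum) (auto simp: lrw_stationary_nonneg sum_lrw_stationary[OF assms])
qed (auto intro: prob_space_return)

lemma Ionescu_Tulcea_lrw:
  assumes G: "graph G" "Digraph_Component.connected G" and n: "card (verts G) \<ge> 2"
    and \<mu>: "prob_space \<mu>" "sets \<mu> = sets (count_space (verts G))"
  shows "Ionescu_Tulcea (lrw_kernel G \<mu>) (\<lambda>_. count_space (verts G))"
proof -
  interpret graph G by fact
  have step: "prob_space (point_measure (verts G) (\<lambda>y. ennreal (lrw_trans G x y)))"
    if "x \<in> verts G" for x
    using sum_lrw_trans[OF G n that]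
    by (intro prob_space_point_measure_sum) (auto simp: lrw_trans_nonneg)
  have "lrw_kernel G \<mu> i \<in> measurable (PiM {0..<i} (\<lambda>_. count_space (verts G)))
          (subprob_algebra (count_space (verts G)))" for i
  proof (cases i)
    case 0
    have "\<mu> \<in> space (subprob_algebra (count_space (verts G)))"
      using \<mu> by (simp add: space_subprob_algebra prob_space_imp_subprob_space)
    then show ?thesis
      by (simp add: 0 lrw_kernel_def[abs_def])
  next
    case (Suc s)
    have 1: "(\<lambda>\<omega>. \<omega> s) \<in> measurable (PiM {0..<i} (\<lambda>_. count_space (verts G))) (count_space (verts G))"
      by (rule measurable_component_singleton) (simp add: Suc)
    have 2: "(\<lambda>x. point_measure (verts G) (\<lambda>y. ennreal (lrw_trans G x y)))
        \<in> measurable (count_space (verts G)) (subprob_algebra (count_space (verts G)))"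
      by (auto simp: space_subprob_algebra sets_point_measure
               intro!: prob_space_imp_subprob_space step)
    show ?thesis
      using measurable_compose[OF 1 2] by (simp add: Suc lrw_kernel_def[abs_def])
  qed
  moreover have "prob_space (lrw_kernel G \<mu> i \<omega>)"
    if "\<omega> \<in> space (PiM {0..<i} (\<lambda>_. count_space (verts G)))" for i \<omega>
    using that \<mu>(1) by (auto simp: lrw_kernel_def space_PiM PiE_iff intro!: step split: nat.split)
  ultimately show ?thesis
    by (rule Ionescu_Tulcea.intro)
qed

lemma sets_lrw:
  assumes G: "graph G" "Digraph_Component.connected G" and n: "card (verts G) \<ge> 2"
    and \<mu>: "prob_space \<mu>" "sets \<mu> = sets (count_space (verts G))"
  shows "sets (lrw G \<mu>) = sets (PiM UNIV (\<lambda>_. count_space (verts G)))"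
proof -
  interpret Ionescu_Tulcea "lrw_kernel G \<mu>" "\<lambda>_. count_space (verts G)"
    by (rule Ionescu_Tulcea_lrw) fact+
  show ?thesis by (simp add: lrw_def)
qed

lemma sets_avoid:
  assumes G: "graph G" "Digraph_Component.connected G" and n: "card (verts G) \<ge> 2"
    and \<mu>: "prob_space \<mu>" "sets \<mu> = sets (count_space (verts G))"
  shows "{\<omega> \<in> space (lrw G \<mu>). \<forall>s\<le>t. \<omega> s \<noteq> h s} \<in> sets (lrw G \<mu>)"
proof -
  note [measurable_cong] = sets_lrw[OF assms]
  show ?thesis by measurable
qed

lemma hitting_time_altdef:
  "hitting_time x \<omega> = (if \<exists>t. \<omega> t = x then enat (LEAST t. \<omega> t = x) else \<infinity>)"
proof (cases "\<exists>t. \<omega> t = x")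
  case True
  then have "\<omega> (LEAST t. \<omega> t = x) = x" by (rule LeastI_ex)
  then have "Inf (enat ` {t. \<omega> t = x}) = enat (LEAST t. \<omega> t = x)"
    by (intro cInf_eq_minimum) (auto intro: Least_le)
  with True show ?thesis by (simp add: hitting_time_def)
next
  case False
  then show ?thesis by (simp add: hitting_time_def top_enat_def)
qed

lemma measurable_hitting_time:
  assumes G: "graph G" "Digraph_Component.connected G" and n: "card (verts G) \<ge> 2"
    and \<mu>: "prob_space \<mu>" "sets \<mu> = sets (count_space (verts G))"
  shows "hitting_time x \<in> measurable (lrw G \<mu>) (count_space UNIV)"
proof -
  note [measurable_cong] = sets_lrw[OF assms]
  show ?thesis unfolding hitting_time_altdef[abs_def] by measurable
qed

lemma emeasure_lrw_cylinder:
  assumes G: "graph G" "Digraph_Component.connected G" and n: "card (verts G) \<ge> 2"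
    and \<mu>: "prob_space \<mu>" "sets \<mu> = sets (count_space (verts G))"
    and x: "\<And>i. i \<le> m \<Longrightarrow> x i \<in> verts G"
  shows "emeasure (lrw G \<mu>) {\<omega> \<in> space (lrw G \<mu>). \<forall>i\<le>m. \<omega> i = x i}
       = emeasure \<mu> {x 0} * (\<Prod>i<m. ennreal (lrw_trans G (x i) (x (Suc i))))"
proof -
  interpret graph G by fact
  interpret IT: Ionescu_Tulcea "lrw_kernel G \<mu>" "\<lambda>_. count_space (verts G)"
    by (rule Ionescu_Tulcea_lrw) fact+
  let ?M = "\<lambda>_::nat. count_space (verts G)"
  let ?r = "\<lambda>k. restrict x {0..<k}"
  have sing: "{?r k} \<in> sets (PiM {0..<k} ?M)" if "k \<le> Suc m" for k
  proof -
    have "{?r k} = PiE {0..<k} (\<lambda>i. {?r k i})"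
      by (rule PiE_singleton[symmetric]) simp
    also have "\<dots> \<in> sets (PiM {0..<k} ?M)"
      using x that by (intro sets_PiM_I_finite) auto
    finally show ?thesis .
  qed
  have r_space: "?r k \<in> space (PiM {0..<k} ?M)" if "k \<le> Suc m" for k
    using x that by (auto simp: space_PiM)
  have C: "emeasure (IT.C 0 (Suc k) (\<lambda>_. undefined)) {?r (Suc k)}
      = emeasure \<mu> {x 0} * (\<Prod>i<k. ennreal (lrw_trans G (x i) (x (Suc i))))" if "k \<le> m" for k
    using that
  proof (induction k)
    case 0
    have u: "(\<lambda>_. undefined) \<in> space (PiM {0..<0} ?M)" by (simp add: space_PiM)
    have "IT.C 0 (Suc 0) (\<lambda>_. undefined) = IT.eP 0 (\<lambda>_. undefined)"
      unfolding IT.C.simps add_0 by (rule bind_return[OF IT.measurable_eP u])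
    moreover have "emeasure (IT.eP 0 (\<lambda>_. undefined)) {?r (Suc 0)}
        = emeasure \<mu> ((\<lambda>z. (\<lambda>_. undefined)(0 := z)) -` {?r (Suc 0)} \<inter> verts G)"
      using IT.emeasure_eP[OF u sing[of "Suc 0"]] by (simp add: lrw_kernel_def)
    moreover have "(\<lambda>z. (\<lambda>_. undefined)(0 := z)) -` {?r (Suc 0)} \<inter> verts G = {x 0}"
      using x[of 0] by (auto simp: fun_eq_iff restrict_def) metis
    ultimately show ?case by (simp only: lessThan_0 prod.empty mult_1_right)
  next
    case (Suc k)
    let ?p = "ennreal (lrw_trans G (x k) (x (Suc k)))"
    have u: "(\<lambda>_. undefined) \<in> space (PiM {0..<0} ?M)" by (simp add: space_PiM)
    have ne: "space (IT.C 0 (Suc k) (\<lambda>_. undefined)) \<noteq> {}"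
      using IT.prob_space_C[OF u] prob_space.not_empty by blast
    have S: "sets (IT.C 0 (Suc k) (\<lambda>_. undefined)) = sets (PiM {0..<Suc k} ?M)"
      using IT.sets_C[OF u, of "Suc k"] by simp
    have mb: "IT.eP (Suc k) \<in> measurable (IT.C 0 (Suc k) (\<lambda>_. undefined))
                (subprob_algebra (PiM {0..<Suc (Suc k)} ?M))"
      using IT.measurable_eP[of "Suc k"] by (simp add: measurable_cong_sets[OF S refl] del: IT.C.simps)
    have eP: "emeasure (IT.eP (Suc k) \<omega>) {?r (Suc (Suc k))} = ?p * indicator {?r (Suc k)} \<omega>"
      if w: "\<omega> \<in> space (PiM {0..<Suc k} ?M)" for \<omega>
    proof -
      have ext: "\<omega> j = undefined" if "j \<ge> Suc k" for j
        using w that by (auto simp: space_PiM PiE_iff extensional_def)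
      have "(\<lambda>z. fun_upd \<omega> (Suc k) z) -` {?r (Suc (Suc k))} \<inter> verts G
          = (if \<omega> = ?r (Suc k) then {x (Suc k)} else {})"
      proof -
        have "fun_upd \<omega> (Suc k) z = ?r (Suc (Suc k)) \<longleftrightarrow> \<omega> = ?r (Suc k) \<and> z = x (Suc k)" for z
        proof
          assume eq: "fun_upd \<omega> (Suc k) z = ?r (Suc (Suc k))"
          have "\<omega> j = ?r (Suc k) j" for j
            using fun_cong[OF eq, of j] ext[of j] by (cases "j < Suc k") auto
          moreover have "z = x (Suc k)" using fun_cong[OF eq, of "Suc k"] by simp
          ultimately show "\<omega> = ?r (Suc k) \<and> z = x (Suc k)" by (auto simp only: fun_eq_iff)
        next
          assume "\<omega> = ?r (Suc k) \<and> z = x (Suc k)"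
          then show "fun_upd \<omega> (Suc k) z = ?r (Suc (Suc k))" by auto
        qed
        then have "(\<lambda>z. fun_upd \<omega> (Suc k) z) -` {?r (Suc (Suc k))} \<inter> verts G
            = {z. \<omega> = ?r (Suc k) \<and> z = x (Suc k)} \<inter> verts G"
          by (simp only: vimage_def singleton_iff)
        also have "\<dots> = (if \<omega> = ?r (Suc k) then {x (Suc k)} else {})"
          using x[of "Suc k"] Suc.prems by (cases "\<omega> = ?r (Suc k)") (simp_all only:, auto)
        finally show ?thesis .
      qed
      then have "emeasure (IT.eP (Suc k) \<omega>) {?r (Suc (Suc k))}
          = emeasure (lrw_kernel G \<mu> (Suc k) \<omega>) (if \<omega> = ?r (Suc k) then {x (Suc k)} else {})"
        using IT.emeasure_eP[OF w sing[of "Suc (Suc k)"]] Suc.prems by simp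
      also have "\<dots> = ?p * indicator {?r (Suc k)} \<omega>"
        using x[of "Suc k"] Suc.prems
        by (auto simp: lrw_kernel_def emeasure_point_measure_finite)
      finally show ?thesis .
    qed
    have "emeasure (IT.C 0 (Suc (Suc k)) (\<lambda>_. undefined)) {?r (Suc (Suc k))}
        = (\<integral>\<^sup>+\<omega>. emeasure (IT.eP (Suc k) \<omega>) {?r (Suc (Suc k))} \<partial>IT.C 0 (Suc k) (\<lambda>_. undefined))"
      using emeasure_bind[OF ne mb sing[of "Suc (Suc k)"]] Suc.prems
      by (simp add: IT.C.simps(2)[of 0 "Suc k"] del: IT.C.simps)
    also have "\<dots> = (\<integral>\<^sup>+\<omega>. ?p * indicator {?r (Suc k)} \<omega> \<partial>IT.C 0 (Suc k) (\<lambda>_. undefined))"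
      using IT.space_C[OF u, of "Suc k"] by (intro nn_integral_cong eP) (simp del: IT.C.simps)
    also have "\<dots> = ?p * emeasure (IT.C 0 (Suc k) (\<lambda>_. undefined)) {?r (Suc k)}"
      using sing[of "Suc k"] Suc.prems S by (simp add: nn_integral_cmult_indicator del: IT.C.simps)
    finally show ?case
      using Suc by (simp add: mult_ac del: IT.C.simps restrict_apply)
  qed
  have "{\<omega> \<in> space (lrw G \<mu>). \<forall>i\<le>m. \<omega> i = x i} = prod_emb UNIV ?M {0..<Suc m} {?r (Suc m)}"
  proof -
    have "space (lrw G \<mu>) = space (PiM UNIV ?M)"
      by (rule sets_eq_imp_space_eq, rule sets_lrw) fact+
    then show ?thesis
      by (auto simp: prod_emb_def space_PiM PiE_iff restrict_def fun_eq_iff less_Suc_eq_le) metis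
  qed
  then show ?thesis
    using IT.lim[of "{0..<Suc m}" "{?r (Suc m)}"] IT.emeasure_CI[of "{0..<Suc m}" "Suc m" "{?r (Suc m)}"]
      sing[of "Suc m"] C[of m] sets.sets_into_space[OF sing[of "Suc m"]]
    by (simp add: lrw_def prod_emb_id space_PiM del: IT.C.simps restrict_apply)
qed

end

theory Submission
  imports Defs
begin

text \<open>
  Write \<open>\<langle>f, g\<rangle>\<close> for the inner product weighted by \<open>\<pi>\<close> and \<open>D\<^sub>z\<close> for the operator that sets a
  function to \<open>0\<close> at \<open>z\<close>.  The probability to be bounded is
  \<open>\<langle>1, D\<^bsub>h 0\<^esub> P D\<^bsub>h 1\<^esub> P \<dots> P D\<^bsub>h t\<^esub> 1\<rangle>\<close>, and there are \<open>t\<close> factors \<open>P\<close>.  Two facts about the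
  symmetric form \<open>B f g = \<langle>f, P g\<rangle>\<close> yield one factor \<open>1 - 1 / t\<^sub>h\<^sub>i\<^sub>t\<close> for each of them.

  Laziness makes \<open>B\<close> positive semidefinite, so that \<open>B\<close> satisfies the Cauchy--Schwarz inequality
  (\<open>form_Cauchy_Schwarz\<close>).  This is what allows the target to move: it plays the role of splitting
  each \<open>P\<close> into two square roots and distributing these to the neighbouring projections, so that
  only the norms of the operators \<open>D\<^sub>z P D\<^sub>z\<close> with a fixed \<open>z\<close> remain.

  Such a norm is controlled by hitting times: \<open>\<phi> x = E\<^sub>x \<tau>\<^sub>z\<close> satisfies \<open>P \<phi> = \<phi> - 1\<close> off \<open>z\<close>, and
  \<open>\<phi> \<le> t\<^sub>h\<^sub>i\<^sub>t\<close>, hence \<open>P \<phi> \<le> (1 - 1 / t\<^sub>h\<^sub>i\<^sub>t) \<phi>\<close> there.  A positive supersolution of the chain killed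
  at \<open>z\<close> bounds its quadratic form (\<open>killed_form_le\<close>), without recourse to eigenvectors.

  The functions \<open>f\<^sub>k = D\<^bsub>h (t - k)\<^esub> P \<dots> P D\<^bsub>h t\<^esub> 1\<close> are survival probabilities, given by the recursion
  \<open>survive\<close>; \<open>emeasure_lrw_survive\<close> identifies them with events of the path measure.  Both the
  avoidance probability and the tails of the hitting times are instances of it.
\<close>

section \<open>Avoiding a moving target\<close>

text \<open>
  The probability, for a chain with kernel \<open>P\<close> started at \<open>x\<close>, of avoiding \<open>h s\<close> at each time
  \<open>s \<le> k\<close>.  Conditioning on the first step, and thus shifting \<open>h\<close>, makes the recursion an
  application of \<open>P\<close> followed by killing at \<open>h 0\<close>.
\<close>

primrec survive :: "'a set \<Rightarrow> ('a \<Rightarrow> 'a \<Rightarrow> real) \<Rightarrow> nat \<Rightarrow> (nat \<Rightarrow> 'a) \<Rightarrow> 'a \<Rightarrow> real" where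
  "survive V P 0 h x = (if x = h 0 then 0 else 1)"
| "survive V P (Suc k) h x =
     (if x = h 0 then 0 else \<Sum>y\<in>V. P x y * survive V P k (\<lambda>s. h (Suc s)) y)"

lemma survive_nonneg:
  assumes "\<And>x y. P x y \<ge> 0"
  shows "survive V P k h x \<ge> 0"
  by (induction k arbitrary: h x) (auto intro!: sum_nonneg mult_nonneg_nonneg assms)

section \<open>Lazy reversible chains\<close>

locale lazy_reversible_chain =
  fixes V :: "'a set" and P :: "'a \<Rightarrow> 'a \<Rightarrow> real" and \<pi> :: "'a \<Rightarrow> real"
  assumes fin: "finite V"
    and P_nonneg: "P x y \<ge> 0"
    and P_sum: "x \<in> V \<Longrightarrow> (\<Sum>y\<in>V. P x y) = 1"
    and lazy: "P x x \<ge> 1 / 2"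
    and pi_nonneg: "\<pi> x \<ge> 0"
    and pi_sum: "(\<Sum>x\<in>V. \<pi> x) = 1"
    and reversible: "x \<in> V \<Longrightarrow> y \<in> V \<Longrightarrow> \<pi> x * P x y = \<pi> y * P y x"
begin

text \<open>The bilinear form \<open>B f g = \<langle>f, P g\<rangle>\<close> of the chain.\<close>

definition form :: "('a \<Rightarrow> real) \<Rightarrow> ('a \<Rightarrow> real) \<Rightarrow> real" where
  "form f g = (\<Sum>x\<in>V. \<pi> x * f x * (\<Sum>y\<in>V. P x y * g y))"

text \<open>Detailed balance: the stationary chain looks the same when a step is run backwards.\<close>

lemma sum_reversed:
  "(\<Sum>x\<in>V. \<Sum>y\<in>V. \<pi> x * P x y * F y x) = (\<Sum>x\<in>V. \<Sum>y\<in>V. \<pi> x * P x y * F x y)"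
proof -
  have "(\<Sum>x\<in>V. \<Sum>y\<in>V. \<pi> x * P x y * F y x) = (\<Sum>y\<in>V. \<Sum>x\<in>V. \<pi> x * P x y * F y x)"
    by (rule sum.swap)
  also have "\<dots> = (\<Sum>y\<in>V. \<Sum>x\<in>V. \<pi> y * P y x * F y x)"
    by (intro sum.cong refl) (simp add: reversible)
  finally show ?thesis .
qed

lemma form_double_sum: "form f g = (\<Sum>x\<in>V. \<Sum>y\<in>V. \<pi> x * P x y * (f x * g y))"
  by (simp add: form_def sum_distrib_left mult_ac)

lemma sum_row: "(\<Sum>x\<in>V. \<Sum>y\<in>V. \<pi> x * P x y * F x) = (\<Sum>x\<in>V. \<pi> x * F x)"
proof (intro sum.cong refl)
  fix x assume "x \<in> V"
  have "(\<Sum>y\<in>V. \<pi> x * P x y * F x) = \<pi> x * F x * (\<Sum>y\<in>V. P x y)"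
    by (simp add: sum_distrib_left mult_ac)
  then show "(\<Sum>y\<in>V. \<pi> x * P x y * F x) = \<pi> x * F x"
    using P_sum[OF \<open>x \<in> V\<close>] by simp
qed

text \<open>
  By laziness \<open>P = (I + Q) / 2\<close> with a stochastic matrix \<open>Q\<close> that is reversible as well, and
  \<open>\<langle>f, (I + Q) g\<rangle>\<close> is half the sum of \<open>\<pi> x Q x y (f x + f y) (g x + g y)\<close>.  The weight below is
  \<open>\<pi> x Q x y / 2\<close>.  Since it is nonnegative, the form is a genuine inner product of the
  families \<open>f x + f y\<close> and \<open>g x + g y\<close>, up to degeneracy.
\<close>

lemma form_eq_sum_of_products:
  "2 * form f g =
    (\<Sum>(x, y)\<in>V \<times> V. \<pi> x * (P x y - (if x = y then 1 / 2 else 0)) * ((f x + f y) * (g x + g y)))"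
proof -
  let ?S = "\<lambda>F. \<Sum>x\<in>V. \<Sum>y\<in>V. \<pi> x * P x y * F x y"
  have diag: "(\<Sum>y\<in>V. \<pi> x * (if x = y then 1 / 2 else 0) * ((f x + f y) * (g x + g y)))
      = 2 * (\<pi> x * (f x * g x))" if "x \<in> V" for x
  proof -
    have "(\<Sum>y\<in>V. \<pi> x * (if x = y then 1 / 2 else 0) * ((f x + f y) * (g x + g y)))
        = (\<Sum>y\<in>V. if x = y then 2 * (\<pi> x * (f x * g x)) else 0)"
      by (intro sum.cong) (auto simp: field_simps)
    then show ?thesis using that fin by simp
  qed
  have "(\<Sum>(x, y)\<in>V \<times> V. \<pi> x * (P x y - (if x = y then 1 / 2 else 0)) * ((f x + f y) * (g x + g y)))
      = ?S (\<lambda>x y. (f x + f y) * (g x + g y))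
        - (\<Sum>x\<in>V. \<Sum>y\<in>V. \<pi> x * (if x = y then 1 / 2 else 0) * ((f x + f y) * (g x + g y)))"
    by (simp add: sum.cartesian_product[symmetric] left_diff_distrib right_diff_distrib sum_subtractf)
  also have "(\<Sum>x\<in>V. \<Sum>y\<in>V. \<pi> x * (if x = y then 1 / 2 else 0) * ((f x + f y) * (g x + g y)))
      = 2 * (\<Sum>x\<in>V. \<pi> x * (f x * g x))"
    unfolding sum_distrib_left by (intro sum.cong refl diag)
  also have "?S (\<lambda>x y. (f x + f y) * (g x + g y))
      = ?S (\<lambda>x y. f x * g x) + ?S (\<lambda>x y. f x * g y) + ?S (\<lambda>x y. f y * g x) + ?S (\<lambda>x y. f y * g y)"
    by (simp add: algebra_simps sum.distrib)
  also have "?S (\<lambda>x y. f y * g x) = ?S (\<lambda>x y. f x * g y)"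
    by (rule sum_reversed[of "\<lambda>x y. f x * g y"])
  also have "?S (\<lambda>x y. f y * g y) = ?S (\<lambda>x y. f x * g x)"
    by (rule sum_reversed[of "\<lambda>x y. f x * g x"])
  finally show ?thesis
    by (simp add: form_double_sum sum_row)
qed

lemma lazy_weight_nonneg: "\<pi> x * (P x y - (if x = y then 1 / 2 else 0)) \<ge> 0"
  using lazy[of x] P_nonneg[of x y] by (auto intro!: mult_nonneg_nonneg pi_nonneg)

lemma form_nonneg: "form f f \<ge> 0"
proof -
  have "2 * form f f \<ge> 0"
    unfolding form_eq_sum_of_products
    by (intro sum_nonneg) (auto intro!: mult_nonneg_nonneg[OF lazy_weight_nonneg])
  then show ?thesis by simp
qed

lemma form_Cauchy_Schwarz: "(form f g)\<^sup>2 \<le> form f f * form g g"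
proof -
  define w where "w = (\<lambda>(x, y). \<pi> x * (P x y - (if x = y then 1 / 2 else 0)))"
  define a where "a = (\<lambda>f. \<lambda>(x, y). sqrt (w (x, y)) * (f x + f y :: real))"
  have *: "2 * form f g = (\<Sum>p\<in>V \<times> V. a f p * a g p)" for f g
    unfolding form_eq_sum_of_products
  proof (intro sum.cong refl, clarify)
    fix x y
    have "sqrt (w (x, y)) * sqrt (w (x, y)) = w (x, y)"
      using lazy_weight_nonneg[of x y] by (simp add: w_def)
    then show "\<pi> x * (P x y - (if x = y then 1 / 2 else 0)) * ((f x + f y) * (g x + g y))
        = a f (x, y) * a g (x, y)"
      by (simp add: a_def) (simp add: w_def mult_ac)
  qed
  have "(2 * form f g)\<^sup>2 \<le> (2 * form f f) * (2 * form g g)"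
    unfolding * using Cauchy_Schwarz_ineq_sum[of "a f" "a g" "V \<times> V"]
    by (simp add: power2_eq_square)
  then show ?thesis by (simp add: power2_eq_square)
qed

text \<open>
  A Schur test with weight \<open>\<phi>\<close>.  The arithmetic-geometric mean inequality gives
  \<open>2 f x f y \<le> (f x)\<^sup>2 \<phi> y / \<phi> x + (f y)\<^sup>2 \<phi> x / \<phi> y\<close>; the two terms have the same sum by
  reversibility, and summing the first over \<open>y\<close> produces \<open>P \<phi>\<close>, which is at most \<open>c \<phi>\<close> wherever
  \<open>f\<close> does not vanish.
\<close>

lemma killed_form_le:
  assumes h: "f h = 0"
    and phi: "\<And>x. x \<in> V \<Longrightarrow> \<phi> x \<ge> 0" "\<And>x. x \<in> V \<Longrightarrow> x \<noteq> h \<Longrightarrow> \<phi> x > 0"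
      "\<And>x. x \<in> V \<Longrightarrow> x \<noteq> h \<Longrightarrow> (\<Sum>y\<in>V. P x y * \<phi> y) \<le> c * \<phi> x"
  shows "form f f \<le> c * (\<Sum>x\<in>V. \<pi> x * (f x)\<^sup>2)"
proof -
  let ?F = "\<lambda>x y. (f x)\<^sup>2 * \<phi> y / \<phi> x"
  have amgm: "2 * (f x * f y) \<le> ?F x y + ?F y x" if "x \<in> V" "y \<in> V" for x y
  proof (cases "x = h \<or> y = h")
    case True
    \<comment> \<open>The left-hand side vanishes, and division by a possible \<open>\<phi> h = 0\<close> gives the harmless value \<open>0\<close>.\<close>
    then show ?thesis using h phi(1)[OF that(1)] phi(1)[OF that(2)] by auto
  next
    case False
    then have p: "\<phi> x > 0" "\<phi> y > 0" using phi(2) that by auto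
    have "?F x y + ?F y x - 2 * (f x * f y) = (f x * \<phi> y - f y * \<phi> x)\<^sup>2 / (\<phi> x * \<phi> y)"
      using p by (simp add: field_simps power2_eq_square)
    moreover have "\<dots> \<ge> 0" using p by simp
    ultimately show ?thesis by linarith
  qed
  have "2 * form f f = (\<Sum>x\<in>V. \<Sum>y\<in>V. \<pi> x * P x y * (2 * (f x * f y)))"
    by (simp add: form_double_sum sum_distrib_left mult_ac)
  also have "\<dots> \<le> (\<Sum>x\<in>V. \<Sum>y\<in>V. \<pi> x * P x y * (?F x y + ?F y x))"
    by (intro sum_mono mult_left_mono amgm mult_nonneg_nonneg pi_nonneg P_nonneg)
  also have "\<dots> = (\<Sum>x\<in>V. \<Sum>y\<in>V. \<pi> x * P x y * ?F x y) + (\<Sum>x\<in>V. \<Sum>y\<in>V. \<pi> x * P x y * ?F y x)"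
    by (simp only: distrib_left sum.distrib)
  also have "\<dots> = 2 * (\<Sum>x\<in>V. \<Sum>y\<in>V. \<pi> x * P x y * ?F x y)"
    using sum_reversed[of ?F] by simp
  also have "\<dots> = 2 * (\<Sum>x\<in>V. \<pi> x * (f x)\<^sup>2 / \<phi> x * (\<Sum>y\<in>V. P x y * \<phi> y))"
    by (simp add: sum_distrib_left sum_divide_distrib mult_ac)
  also have "\<dots> \<le> 2 * (\<Sum>x\<in>V. c * (\<pi> x * (f x)\<^sup>2))"
  proof (intro mult_left_mono sum_mono)
    fix x assume x: "x \<in> V"
    show "\<pi> x * (f x)\<^sup>2 / \<phi> x * (\<Sum>y\<in>V. P x y * \<phi> y) \<le> c * (\<pi> x * (f x)\<^sup>2)"
    proof (cases "x = h")
      case False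
      have "\<pi> x * (f x)\<^sup>2 / \<phi> x * (\<Sum>y\<in>V. P x y * \<phi> y) \<le> \<pi> x * (f x)\<^sup>2 / \<phi> x * (c * \<phi> x)"
        using phi(1)[OF x] pi_nonneg by (intro mult_left_mono phi(3) x False) simp
      also have "\<dots> = c * (\<pi> x * (f x)\<^sup>2)" using phi(2)[OF x False] by simp
      finally show ?thesis .
    qed (use h in simp)
  qed simp
  finally show ?thesis by (simp flip: sum_distrib_left)
qed

text \<open>
  Put \<open>f = D P g\<close> with the projection \<open>D\<close> that kills \<open>h 0\<close>.  Then \<open>\<langle>f, f\<rangle> = \<langle>f, P g\<rangle> = B f g\<close>, so
  \<open>B f f \<le> c (B f g)\<close>, and Cauchy--Schwarz turns this into \<open>B f f \<le> c\<^sup>2 (B g g)\<close>.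
  Each step of the chain thus contributes \<open>c\<^sup>2\<close>, and the innermost function \<open>D 1\<close> contributes \<open>c\<close>.
\<close>

lemma survive_form_le:
  assumes "c \<ge> 0"
    and killed: "\<And>f z. z \<in> V \<Longrightarrow> f z = 0 \<Longrightarrow> form f f \<le> c * (\<Sum>x\<in>V. \<pi> x * (f x)\<^sup>2)"
    and h: "\<And>s. s \<le> k \<Longrightarrow> h s \<in> V"
  shows "form (survive V P k h) (survive V P k h) \<le> c ^ (2 * k + 1)"
  using h
proof (induction k arbitrary: h)
  case 0
  let ?f = "survive V P 0 h"
  have "form ?f ?f \<le> c * (\<Sum>x\<in>V. \<pi> x * (?f x)\<^sup>2)"
    using 0 by (intro killed[of "h 0"]) auto
  also have "\<dots> \<le> c * (\<Sum>x\<in>V. \<pi> x)"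
    by (intro mult_left_mono sum_mono) (auto simp: pi_nonneg \<open>c \<ge> 0\<close>)
  finally show ?case by (simp only: pi_sum mult_1_right mult_0_right add_0 power_one_right)
next
  case (Suc k)
  let ?g = "survive V P k (\<lambda>s. h (Suc s))" and ?f = "survive V P (Suc k) h"
  let ?a = "form ?f ?f"
  have IH: "form ?g ?g \<le> c ^ (2 * k + 1)"
    using Suc.prems by (intro Suc.IH) simp
  have "?a \<le> c * (\<Sum>x\<in>V. \<pi> x * (?f x)\<^sup>2)"
    using Suc.prems by (intro killed[of "h 0"]) auto
  also have "(\<Sum>x\<in>V. \<pi> x * (?f x)\<^sup>2) = form ?f ?g"
    unfolding form_def by (intro sum.cong) (auto simp: power2_eq_square)
  finally have "?a\<^sup>2 \<le> (c * form ?f ?g)\<^sup>2"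
    by (intro power_mono form_nonneg)
  also have "\<dots> \<le> c\<^sup>2 * (?a * form ?g ?g)"
    unfolding power_mult_distrib by (intro mult_left_mono form_Cauchy_Schwarz) simp
  also have "\<dots> \<le> c\<^sup>2 * (?a * c ^ (2 * k + 1))"
    by (intro mult_left_mono IH form_nonneg) simp
  finally have "?a * ?a \<le> ?a * c ^ (2 * Suc k + 1)"
    by (simp add: power2_eq_square mult_ac)
  moreover have "a \<le> r" if "a * a \<le> a * r" "a \<ge> 0" "r \<ge> 0" for a r :: real
    using that by (cases "a = 0") (auto simp: mult_le_cancel_left)
  ultimately show ?case
    using form_nonneg zero_le_power[OF \<open>c \<ge> 0\<close>] by blast
qed

text \<open>
  The probability is \<open>B f g\<close> with \<open>f = D 1\<close> and \<open>g\<close> the survival function after the first step.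
  Cauchy--Schwarz and the preceding bound give \<open>c \<cdot> c\<^bsup>2 (t - 1) + 1\<^esup> = (c\<^sup>t)\<^sup>2\<close> for its square.
\<close>

theorem stationary_survive_le:
  assumes "c \<ge> 0"
    and killed: "\<And>f z. z \<in> V \<Longrightarrow> f z = 0 \<Longrightarrow> form f f \<le> c * (\<Sum>x\<in>V. \<pi> x * (f x)\<^sup>2)"
    and h: "\<And>s. s \<le> t \<Longrightarrow> h s \<in> V" and t: "t \<ge> 1"
  shows "(\<Sum>x\<in>V. \<pi> x * survive V P t h x) \<le> c ^ t"
proof -
  obtain k where k: "t = Suc k" using t by (cases t) auto
  let ?f = "survive V P 0 h" and ?g = "survive V P k (\<lambda>s. h (Suc s))"
  have "(\<Sum>x\<in>V. \<pi> x * survive V P t h x) = form ?f ?g"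
    unfolding form_def k by (intro sum.cong) auto
  moreover have "(form ?f ?g)\<^sup>2 \<le> (c ^ t)\<^sup>2"
  proof -
    have "(form ?f ?g)\<^sup>2 \<le> form ?f ?f * form ?g ?g"
      by (rule form_Cauchy_Schwarz)
    also have "\<dots> \<le> c ^ (2 * 0 + 1) * c ^ (2 * k + 1)"
      using h k by (intro mult_mono survive_form_le killed form_nonneg zero_le_power \<open>c \<ge> 0\<close>) auto
    also have "\<dots> = (c ^ t)\<^sup>2"
      by (simp add: k power_mult_distrib flip: power_mult power_add) (simp add: power2_eq_square power_add mult_2 mult_2_right)
    finally show ?thesis .
  qed
  ultimately show ?thesis
    using \<open>c \<ge> 0\<close> by (metis power2_le_imp_le zero_le_power)
qed

end

section \<open>Survival probabilities of the lazy random walk\<close>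

text \<open>
  The finite-dimensional distributions suffice, and no Markov property of the path measure has
  to be established: for a path prescribed up to time \<open>m\<close> and a target to be avoided from time
  \<open>m\<close> on, induction on the number of remaining steps, splitting according to the state at time
  \<open>m + 1\<close>, reduces everything to cylinder probabilities.
\<close>

lemma emeasure_lrw_survive:
  assumes G: "graph G" "Digraph_Component.connected G" and n: "card (verts G) \<ge> 2"
    and \<mu>: "prob_space \<mu>" "sets \<mu> = sets (count_space (verts G))"
  shows "emeasure (lrw G \<mu>) {\<omega> \<in> space (lrw G \<mu>). \<forall>s\<le>k. \<omega> s \<noteq> h s}
       = (\<Sum>x\<in>verts G. emeasure \<mu> {x} * ennreal (survive (verts G) (lrw_trans G) k h x))"
proof -
  interpret graph G by fact
  let ?M = "lrw G \<mu>" and ?S = "survive (verts G) (lrw_trans G)"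
  note [measurable_cong] = sets_lrw[OF assms]
  have sp: "space ?M = UNIV \<rightarrow>\<^sub>E verts G"
    using sets_eq_imp_space_eq[OF sets_lrw[OF assms]] by (simp add: space_PiM)
  have split: "emeasure ?M {\<omega> \<in> space ?M. Q \<omega>} = (\<Sum>y\<in>verts G. emeasure ?M {\<omega> \<in> space ?M. \<omega> j = y \<and> Q \<omega>})"
    if [measurable]: "Measurable.pred ?M Q" for Q j
  proof -
    have "{\<omega> \<in> space ?M. Q \<omega>} = (\<Union>y\<in>verts G. {\<omega> \<in> space ?M. \<omega> j = y \<and> Q \<omega>})"
      by (auto simp: sp)
    also have "emeasure ?M \<dots> = (\<Sum>y\<in>verts G. emeasure ?M {\<omega> \<in> space ?M. \<omega> j = y \<and> Q \<omega>})"
      by (rule sum_emeasure[symmetric]) (auto simp: disjoint_family_on_def)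
    finally show ?thesis .
  qed
  have main: "emeasure ?M {\<omega> \<in> space ?M. (\<forall>i\<le>m. \<omega> i = x i) \<and> (\<forall>s\<le>k. \<omega> (m + s) \<noteq> h s)}
      = emeasure ?M {\<omega> \<in> space ?M. \<forall>i\<le>m. \<omega> i = x i} * ennreal (?S k h (x m))"
    if "\<And>i. i \<le> m \<Longrightarrow> x i \<in> verts G" for m x h
    using that
  proof (induction k arbitrary: m x h)
    case 0
    have "{\<omega> \<in> space ?M. (\<forall>i\<le>m. \<omega> i = x i) \<and> (\<forall>s\<le>0. \<omega> (m + s) \<noteq> h s)}
      = (if x m = h 0 then {} else {\<omega> \<in> space ?M. \<forall>i\<le>m. \<omega> i = x i})"
      by auto
    then show ?case by simp
  next
    case (Suc k)
    let ?x = "\<lambda>y. x(Suc m := y)"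
    let ?C = "\<lambda>m x. emeasure ?M {\<omega> \<in> space ?M. \<forall>i\<le>m. \<omega> i = x i}"
    show ?case
    proof (cases "x m = h 0")
      case True
      then have "{\<omega> \<in> space ?M. (\<forall>i\<le>m. \<omega> i = x i) \<and> (\<forall>s\<le>Suc k. \<omega> (m + s) \<noteq> h s)} = {}"
        by auto
      then show ?thesis using True by (simp only:) simp
    next
      case False
      have cyl: "?C (Suc m) (?x y) = ?C m x * ennreal (lrw_trans G (x m) y)" if "y \<in> verts G" for y
      proof -
        have "?C (Suc m) (?x y)
            = emeasure \<mu> {x 0} * (\<Prod>i<Suc m. ennreal (lrw_trans G (?x y i) (?x y (Suc i))))"
          using Suc.prems that by (subst emeasure_lrw_cylinder[OF assms]) auto
        also have "\<dots> = emeasure \<mu> {x 0} * (\<Prod>i<m. ennreal (lrw_trans G (x i) (x (Suc i))))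
            * ennreal (lrw_trans G (x m) y)"
          by (simp add: mult_ac)
        also have "emeasure \<mu> {x 0} * (\<Prod>i<m. ennreal (lrw_trans G (x i) (x (Suc i)))) = ?C m x"
          using Suc.prems by (subst emeasure_lrw_cylinder[OF assms]) auto
        finally show ?thesis .
      qed
      have ev: "(\<omega> (Suc m) = y \<and> ((\<forall>i\<le>m. \<omega> i = x i) \<and> (\<forall>s\<le>Suc k. \<omega> (m + s) \<noteq> h s)))
          \<longleftrightarrow> ((\<forall>i\<le>Suc m. \<omega> i = ?x y i) \<and> (\<forall>s\<le>k. \<omega> (Suc m + s) \<noteq> h (Suc s)))" for y \<omega>
      proof -
        have "(\<forall>s\<le>Suc k. \<omega> (m + s) \<noteq> h s) \<longleftrightarrow> \<omega> m \<noteq> h 0 \<and> (\<forall>s\<le>k. \<omega> (Suc m + s) \<noteq> h (Suc s))"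
          using All_less_Suc2[of "Suc k" "\<lambda>s. \<omega> (m + s) \<noteq> h s"] by (simp add: less_Suc_eq_le)
        moreover have "(\<forall>i\<le>Suc m. \<omega> i = ?x y i) \<longleftrightarrow> (\<forall>i\<le>m. \<omega> i = x i) \<and> \<omega> (Suc m) = y"
          by (auto simp: le_Suc_eq)
        ultimately show ?thesis
          using False by (metis order_refl)
      qed
      have "emeasure ?M {\<omega> \<in> space ?M. (\<forall>i\<le>m. \<omega> i = x i) \<and> (\<forall>s\<le>Suc k. \<omega> (m + s) \<noteq> h s)}
        = (\<Sum>y\<in>verts G. emeasure ?M {\<omega> \<in> space ?M. \<omega> (Suc m) = y \<and>
              ((\<forall>i\<le>m. \<omega> i = x i) \<and> (\<forall>s\<le>Suc k. \<omega> (m + s) \<noteq> h s))})"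
        by (rule split) measurable
      also have "\<dots> = (\<Sum>y\<in>verts G. emeasure ?M {\<omega> \<in> space ?M.
              (\<forall>i\<le>Suc m. \<omega> i = ?x y i) \<and> (\<forall>s\<le>k. \<omega> (Suc m + s) \<noteq> h (Suc s))})"
        by (simp only: ev)
      also have "\<dots> = (\<Sum>y\<in>verts G. ?C (Suc m) (?x y) * ennreal (?S k (\<lambda>s. h (Suc s)) (?x y (Suc m))))"
        using Suc.prems by (intro sum.cong refl Suc.IH) (auto simp: le_Suc_eq)
      also have "\<dots> = (\<Sum>y\<in>verts G. ?C m x * ennreal (lrw_trans G (x m) y * ?S k (\<lambda>s. h (Suc s)) y))"
        by (intro sum.cong refl)
           (simp only: cyl fun_upd_same ennreal_mult lrw_trans_nonneg survive_nonneg mult.assoc)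
      also have "\<dots> = ?C m x * ennreal (?S (Suc k) h (x m))"
        using False
        by (simp add: sum_distrib_left[symmetric] sum_ennreal lrw_trans_nonneg survive_nonneg)
      finally show ?thesis .
    qed
  qed
  have "emeasure ?M {\<omega> \<in> space ?M. \<forall>s\<le>k. \<omega> s \<noteq> h s}
      = (\<Sum>y\<in>verts G. emeasure ?M {\<omega> \<in> space ?M. \<omega> 0 = y \<and> (\<forall>s\<le>k. \<omega> s \<noteq> h s)})"
    by (rule split) measurable
  also have "\<dots> = (\<Sum>y\<in>verts G. emeasure \<mu> {y} * ennreal (?S k h y))"
  proof (intro sum.cong refl)
    fix y assume y: "y \<in> verts G"
    show "emeasure ?M {\<omega> \<in> space ?M. \<omega> 0 = y \<and> (\<forall>s\<le>k. \<omega> s \<noteq> h s)} = emeasure \<mu> {y} * ennreal (?S k h y)"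
      using main[of 0 "\<lambda>_. y" h] emeasure_lrw_cylinder[OF assms, of 0 "\<lambda>_. y"] y by simp
  qed
  finally show ?thesis .
qed

lemma emeasure_lrw_stat_survive:
  assumes G: "graph G" "Digraph_Component.connected G" and n: "card (verts G) \<ge> 2"
  shows "emeasure (lrw_stat G) {\<omega> \<in> space (lrw_stat G). \<forall>s\<le>k. \<omega> s \<noteq> h s}
       = ennreal (\<Sum>x\<in>verts G. lrw_stationary G x * survive (verts G) (lrw_trans G) k h x)"
proof -
  interpret graph G by fact
  show ?thesis
    by (subst emeasure_lrw_survive[OF assms prob_space_lrw_init(1)[OF assms]])
       (simp_all add: sets_point_measure emeasure_point_measure_finite lrw_stationary_nonneg
          survive_nonneg lrw_trans_nonneg ennreal_mult[symmetric] sum_ennreal)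
qed

definition expected_hitting_time :: "('a, 'b) pre_digraph \<Rightarrow> 'a \<Rightarrow> 'a \<Rightarrow> ennreal" where
  "expected_hitting_time G z x = (\<integral>\<^sup>+ \<omega>. ennreal_of_enat (hitting_time z \<omega>) \<partial>lrw_from G x)"

text \<open>
  The tail sum formula; \<open>\<tau>\<^sub>z > k\<close> means that the constant target \<open>z\<close> is avoided up to time \<open>k\<close>.
\<close>

lemma expected_hitting_time_eq_suminf:
  assumes G: "graph G" "Digraph_Component.connected G" and n: "card (verts G) \<ge> 2"
    and x: "x \<in> verts G"
  shows "expected_hitting_time G z x
       = (\<Sum>k. ennreal (survive (verts G) (lrw_trans G) k (\<lambda>_. z) x))"
proof -
  interpret graph G by fact
  let ?\<mu> = "return (count_space (verts G)) x"
  note \<mu> = prob_space_lrw_init(2)[OF G n x] sets_return[of "count_space (verts G)" x]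
  have lt: "enat k < hitting_time z \<omega> \<longleftrightarrow> (\<forall>s\<le>k. \<omega> s \<noteq> z)" for k \<omega>
  proof (cases "\<exists>t. \<omega> t = z")
    case True
    define m where "m = (LEAST t. \<omega> t = z)"
    have "\<omega> m = z" using True unfolding m_def by (rule LeastI_ex)
    moreover have "\<omega> s \<noteq> z" if "s < m" for s
      using that unfolding m_def by (rule not_less_Least)
    moreover have "hitting_time z \<omega> = enat m"
      using True by (simp add: hitting_time_altdef m_def)
    ultimately show ?thesis
      by (auto simp: not_less[symmetric])
  qed (auto simp: hitting_time_altdef)
  have "expected_hitting_time G z x
      = (\<Sum>k. emeasure (lrw_from G x) {\<omega> \<in> space (lrw_from G x). enat k < hitting_time z \<omega>})"
    unfolding expected_hitting_time_def
    by (rule nn_integral_enat_function[OF measurable_hitting_time[OF G n \<mu>]])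
  also have "\<dots> = (\<Sum>k. ennreal (survive (verts G) (lrw_trans G) k (\<lambda>_. z) x))"
  proof (intro suminf_cong)
    fix k
    have "(\<Sum>y\<in>verts G. emeasure ?\<mu> {y} * ennreal (survive (verts G) (lrw_trans G) k (\<lambda>_. z) y))
      = (\<Sum>y\<in>verts G. if x = y then ennreal (survive (verts G) (lrw_trans G) k (\<lambda>_. z) y) else 0)"
      by (intro sum.cong refl) auto
    then show "emeasure (lrw_from G x) {\<omega> \<in> space (lrw_from G x). enat k < hitting_time z \<omega>}
        = ennreal (survive (verts G) (lrw_trans G) k (\<lambda>_. z) x)"
      using emeasure_lrw_survive[OF G n \<mu>, of k "\<lambda>_. z"] x by (simp add: lt)
  qed
  finally show ?thesis .
qed

text \<open>
  Summing the recursion of the survival probabilities over all times.  As the values are extended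
  nonnegative reals, the identity holds whether or not the expectations are finite.
\<close>

lemma expected_hitting_time_first_step:
  assumes G: "graph G" "Digraph_Component.connected G" and n: "card (verts G) \<ge> 2"
    and x: "x \<in> verts G" "x \<noteq> z"
  shows "expected_hitting_time G z x
       = 1 + (\<Sum>y\<in>verts G. ennreal (lrw_trans G x y) * expected_hitting_time G z y)"
proof -
  let ?u = "\<lambda>k x. ennreal (survive (verts G) (lrw_trans G) k (\<lambda>_. z) x)"
  have "(\<Sum>k. ?u k x) = (\<Sum>k. ?u (Suc k) x) + ?u 0 x"
    using suminf_offset[of "\<lambda>k. ?u k x" 1] by (simp add: add_ac)
  also have "?u 0 x = 1" using x by simp
  also have "(\<Sum>k. ?u (Suc k) x) = (\<Sum>k. \<Sum>y\<in>verts G. ennreal (lrw_trans G x y) * ?u k y)"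
    using x by (simp add: ennreal_mult[symmetric] lrw_trans_nonneg survive_nonneg sum_ennreal)
  also have "\<dots> = (\<Sum>y\<in>verts G. \<Sum>k. ennreal (lrw_trans G x y) * ?u k y)"
    by (rule suminf_sum) simp
  also have "\<dots> = (\<Sum>y\<in>verts G. ennreal (lrw_trans G x y) * expected_hitting_time G z y)"
    by (intro sum.cong refl) (simp add: expected_hitting_time_eq_suminf[OF G n])
  finally show ?thesis
    unfolding expected_hitting_time_eq_suminf[OF G n x(1)] by (simp only: add.commute)
qed

lemma expected_hitting_time_le_t_hit:
  assumes "graph G" "x \<in> verts G" "z \<in> verts G"
  shows "expected_hitting_time G z x \<le> t_hit G"
proof -
  interpret graph G by fact
  let ?f = "\<lambda>(z, x). \<integral>\<^sup>+ \<omega>. ennreal_of_enat (hitting_time z \<omega>) \<partial>lrw_from G x"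
  have "?f (z, x) \<in> ?f ` (verts G \<times> verts G)"
    by (rule imageI) (use assms in simp)
  then have "?f (z, x) \<le> Max (?f ` (verts G \<times> verts G))"
    by (rule Max_ge[rotated]) simp
  then show ?thesis
    by (simp add: t_hit_def expected_hitting_time_def)
qed

theorem theorem3:
  fixes G :: "('a, 'b) pre_digraph" and h :: "nat \<Rightarrow> 'a" and t :: nat
  assumes "graph G" and "Digraph_Component.connected G" and "card (verts G) \<ge> 2"
    and "t \<ge> 1" and "\<And>s. s \<le> t \<Longrightarrow> h s \<in> verts G"
  shows "emeasure (lrw_stat G) {\<omega> \<in> space (lrw_stat G). \<forall>s\<le>t. \<omega> s \<noteq> h s}
           \<le> (1 - 1 / t_hit G) ^ t"
proof -
  note G = assms(1-3)
  interpret graph G by fact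
  interpret lazy_reversible_chain "verts G" "lrw_trans G" "lrw_stationary G"
  proof
    fix x y assume x: "x \<in> verts G" and y: "y \<in> verts G"
    show "lrw_stationary G x * lrw_trans G x y = lrw_stationary G y * lrw_trans G y x"
      using out_degree_pos[OF G x] out_degree_pos[OF G y]
        arcs_ends_symmetric[OF sym_arcs, of x y] arcs_ends_symmetric[OF sym_arcs, of y x]
      by (auto simp: lrw_trans_def lrw_stationary_def)
  qed (auto simp: lrw_trans_nonneg sum_lrw_trans[OF G] lrw_stationary_nonneg sum_lrw_stationary[OF G],
       simp add: lrw_trans_def)
  show ?thesis
  proof (cases "t_hit G")
    case top
    \<comment> \<open>Here the bound is \<open>1\<close>, which is the case \<open>c = 1\<close> with the constant supersolution.\<close>
    have "form f f \<le> 1 * (\<Sum>x\<in>verts G. lrw_stationary G x * (f x)\<^sup>2)"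
      if "z \<in> verts G" "f z = 0" for f z
      by (rule killed_form_le[where h = z and \<phi> = "\<lambda>_. 1"]) (simp_all add: that P_sum)
    then have "(\<Sum>x\<in>verts G. lrw_stationary G x * survive (verts G) (lrw_trans G) t h x) \<le> 1 ^ t"
      by (intro stationary_survive_le assms(4,5)) auto
    then show ?thesis
      by (simp add: top emeasure_lrw_stat_survive[OF G])
  next
    case (real T)
    let ?E = "expected_hitting_time G"
    define \<phi> where "\<phi> z x = enn2real (?E z x)" for z x
    have \<phi>: "?E z x = ennreal (\<phi> z x)" "\<phi> z x \<le> T" if "x \<in> verts G" "z \<in> verts G" for x z
    proof -
      have le: "?E z x \<le> ennreal T"
        using expected_hitting_time_le_t_hit[OF G(1) that] real by simp
      then show *: "?E z x = ennreal (\<phi> z x)"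
        unfolding \<phi>_def by (metis ennreal_enn2real ennreal_less_top order_le_less_trans)
      show "\<phi> z x \<le> T"
        using le real by (simp add: *)
    qed
    have \<phi>_nonneg: "\<phi> z x \<ge> 0" for z x by (simp add: \<phi>_def)
    have step: "\<phi> z x = 1 + (\<Sum>y\<in>verts G. lrw_trans G x y * \<phi> z y)"
      if "x \<in> verts G" "z \<in> verts G" "x \<noteq> z" for x z
    proof -
      have "ennreal (\<phi> z x) = ennreal 1 + (\<Sum>y\<in>verts G. ennreal (lrw_trans G x y) * ennreal (\<phi> z y))"
        using expected_hitting_time_first_step[OF G that(1,3)] that(2) by (simp add: \<phi> that)
      also have "\<dots> = ennreal (1 + (\<Sum>y\<in>verts G. lrw_trans G x y * \<phi> z y))"
        by (subst ennreal_plus)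
           (simp_all add: ennreal_mult[symmetric] lrw_trans_nonneg \<phi>_nonneg sum_nonneg)
      finally show ?thesis
        by (subst (asm) ennreal_inj) (simp_all add: \<phi>_nonneg lrw_trans_nonneg sum_nonneg add_nonneg_nonneg)
    qed
    have \<phi>_ge_1: "\<phi> z x \<ge> 1" if "x \<in> verts G" "z \<in> verts G" "x \<noteq> z" for x z
      unfolding step[OF that] by (simp add: lrw_trans_nonneg \<phi>_nonneg sum_nonneg)
    \<comment> \<open>A second vertex has hitting time at least \<open>1\<close>; hence \<open>1 - 1 / T\<close> is not truncated in \<open>ennreal\<close>.\<close>
    have T: "T \<ge> 1"
    proof -
      have h0: "h 0 \<in> verts G" using assms(5) by simp
      have "\<not> verts G \<subseteq> {h 0}"
        using G(3) card_mono[of "{h 0}" "verts G"] by fastforce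
      then obtain x where x: "x \<in> verts G" "x \<noteq> h 0" by blast
      show ?thesis using \<phi>_ge_1[OF x(1) h0 x(2)] \<phi>(2)[OF x(1) h0] by linarith
    qed
    define c where "c = 1 - 1 / T"
    have c: "c \<ge> 0" using T by (simp add: c_def)
    have "form f f \<le> c * (\<Sum>x\<in>verts G. lrw_stationary G x * (f x)\<^sup>2)"
      if z: "z \<in> verts G" and "f z = 0" for f z
    proof (rule killed_form_le[where h = z and \<phi> = "\<phi> z"])
      fix x assume x: "x \<in> verts G" "x \<noteq> z"
      show "\<phi> z x > 0" using \<phi>_ge_1[OF x(1) z x(2)] by simp
      have "\<phi> z x / T \<le> 1" using \<phi>(2)[OF x(1) z] T by simp
      moreover have "c * \<phi> z x = \<phi> z x - \<phi> z x / T" by (simp add: c_def left_diff_distrib)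
      ultimately show "(\<Sum>y\<in>verts G. lrw_trans G x y * \<phi> z y) \<le> c * \<phi> z x"
        using step[OF x(1) z x(2)] by linarith
    qed (simp_all add: \<phi>_nonneg that)
    then have "(\<Sum>x\<in>verts G. lrw_stationary G x * survive (verts G) (lrw_trans G) t h x) \<le> c ^ t"
      by (intro stationary_survive_le c assms(4,5))
    then have "emeasure (lrw_stat G) {\<omega> \<in> space (lrw_stat G). \<forall>s\<le>t. \<omega> s \<noteq> h s} \<le> ennreal (c ^ t)"
      unfolding emeasure_lrw_stat_survive[OF G] by (rule ennreal_leI)
    also have "ennreal (c ^ t) = (1 - 1 / t_hit G) ^ t"
    proof -
      have "1 / t_hit G = ennreal 1 / ennreal T" using real by simp
      also have "\<dots> = ennreal (1 / T)" using T by (intro divide_ennreal) auto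
      finally have "1 - 1 / t_hit G = ennreal 1 - ennreal (1 / T)" by simp
      also have "\<dots> = ennreal c" unfolding c_def using T by (intro ennreal_minus) simp
      finally show ?thesis using c by (simp add: ennreal_power)
    qed
    finally show ?thesis .
  qed
qed

end
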